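(* Let $G=(V,E)$ be a finite strongly connected simple digraph with $|V|=n$ and distance matrix $D$, such that both $DK=n\mathbf 1$ and $D^TK=n\mathbf 1$ admit solutions. Suppose that $G$ has nonnegative out-curvature $\mu^{\mathrm{out}}$. Then $$\mathrm{rad}^-(G)\ \le\ \frac{n^2}{\|\mu^{\mathrm{in}}\|_{\ell_1}}-(n-2),$$ with equality only if there exist $v_0,w_0\in V$ such that $d(w,v_0)=1$ for every $w\neq v_0,w_0$ and $d(w_0,v_0)=\mathrm{rad}^-(G)$.
   Context: A digraph is simple if it has no multiple arcs and no loops (opposite arcs may both be present); it is strongly connected if every vertex is reachable from every other by a directed path; $d(v,w)$ is the length of a shortest directed path from $v$ to $w$; $D=(d(v,w))_{v,w\in V}$; $\mathbf 1\in\mathbb R^n$ is the all-ones column vector. The in-radius is $\mathrm{rad}^-(G)=\min_{x\in V}\max_{v\in V}d(v,x)$. Steinerberger curvatures of the digraph: the out-curvature $\mu^{\mathrm{out}}:V\to\mathbb R$ is the solution of $DK=n\mathbf 1$ if it is unique, and if there are several solutions it is the one achieving $\max_K\min_i K_i$ over all solutions $K$; the in-curvature $\mu^{\mathrm{in}}:V\to\mathbb R$ is defined in the same way with $D^TK=n\mathbf 1$ in place of $DK=n\mathbf 1$. Thus $\sum_{w}d(v,w)\mu^{\mathrm{out}}(w)=n$ and $\sum_w d(w,v)\mu^{\mathrm{in}}(w)=n$ for all $v\in V$. Notation: $\|\mu\|_{\ell_1}=\sum_{w\in V}\mu(w)$. *)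

theory Defs
  imports
    "Graph_Theory.Digraph_Component"
    "Graph_Theory.Shortest_Path"
begin

text \<open>
  The distance of the paper is the library's shortest-path cost for unit arc weights.
  The library takes the infimum over all walks, in the extended reals; under strong
  connectivity it is finite and attained by a path, so the conversion to a real loses nothing.
\<close>

definition digraph_dist :: "('a, 'b) pre_digraph \<Rightarrow> 'a \<Rightarrow> 'a \<Rightarrow> real" where
  "digraph_dist G v w = real_of_ereal (wf_digraph.\<mu> G (\<lambda>_. 1) v w)"

definition in_radius :: "('a, 'b) pre_digraph \<Rightarrow> real" where
  "in_radius G =
     Min ((\<lambda>x. Max ((\<lambda>v. digraph_dist G v x) ` verts G)) ` verts G)"

text \<open>
  Vectors indexed by the vertex set are functions of which only the values on
  \<^term>\<open>verts G\<close> matter. The two predicates below are the systems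
  \<open>D K = n 1\<close> and \<open>D\<^sup>T K = n 1\<close>.
\<close>

definition out_solution :: "('a, 'b) pre_digraph \<Rightarrow> ('a \<Rightarrow> real) \<Rightarrow> bool" where
  "out_solution G K \<longleftrightarrow>
     (\<forall>v\<in>verts G. (\<Sum>w\<in>verts G. digraph_dist G v w * K w) = real (card (verts G)))"

definition in_solution :: "('a, 'b) pre_digraph \<Rightarrow> ('a \<Rightarrow> real) \<Rightarrow> bool" where
  "in_solution G K \<longleftrightarrow>
     (\<forall>v\<in>verts G. (\<Sum>w\<in>verts G. digraph_dist G w v * K w) = real (card (verts G)))"

text \<open>
  A curvature is a solution whose least entry is as large as possible among all solutions.
  When the solution is unique (on the vertices), this condition holds trivially, as the two
  lemmas below record. The maximiser is not required to be unique: the predicates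
  admit every maximising solution.
\<close>

definition is_out_curvature :: "('a, 'b) pre_digraph \<Rightarrow> ('a \<Rightarrow> real) \<Rightarrow> bool" where
  "is_out_curvature G K \<longleftrightarrow> is_arg_max (\<lambda>K. Min (K ` verts G)) (out_solution G) K"

definition is_in_curvature :: "('a, 'b) pre_digraph \<Rightarrow> ('a \<Rightarrow> real) \<Rightarrow> bool" where
  "is_in_curvature G K \<longleftrightarrow> is_arg_max (\<lambda>K. Min (K ` verts G)) (in_solution G) K"

lemma is_out_curvature_if_unique:
  assumes "out_solution G K" "\<And>L v. out_solution G L \<Longrightarrow> v \<in> verts G \<Longrightarrow> L v = K v"
  shows "is_out_curvature G K"
proof -
  have "\<not> Min (K ` verts G) < Min (L ` verts G)" if "out_solution G L" for L
  proof -
    have "L ` verts G = K ` verts G"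
      using assms(2)[OF that] by (rule image_cong[OF refl])
    then show ?thesis by simp
  qed
  with assms(1) show ?thesis
    by (simp add: is_out_curvature_def is_arg_max_def)
qed

lemma is_in_curvature_if_unique:
  assumes "in_solution G K" "\<And>L v. in_solution G L \<Longrightarrow> v \<in> verts G \<Longrightarrow> L v = K v"
  shows "is_in_curvature G K"
proof -
  have "\<not> Min (K ` verts G) < Min (L ` verts G)" if "in_solution G L" for L
  proof -
    have "L ` verts G = K ` verts G"
      using assms(2)[OF that] by (rule image_cong[OF refl])
    then show ?thesis by simp
  qed
  with assms(1) show ?thesis
    by (simp add: is_in_curvature_def is_arg_max_def)
qed

end

theory Submission
  imports Defs
begin

text \<open>
  Write \<open>s(w) = \<Sum>\<^sub>v d(v,w)\<close> for the column sums of the distance matrix. Everything rests on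
  computing two weighted sums of distances in two orders.

  Pairing \<open>\<mu>_in\<^sup>T D \<mu>_out\<close> either way shows that the two curvatures have the same total
  mass \<open>S\<close> (lemma \<open>out_solution_sum_eq_in_solution_sum\<close>). This is why a bound that
  mentions \<open>\<mu>_in\<close> can be obtained from the sign of \<open>\<mu>_out\<close>. Summing the
  equations of \<open>D \<mu>_out = n 1\<close> over all rows gives \<open>\<Sum>\<^sub>w s(w) \<mu>_out(w) = n\<^sup>2\<close>. In
  particular \<open>\<mu>_out\<close> does not vanish identically, so \<open>S > 0\<close> by nonnegativity, and
  \<open>n\<^sup>2 / S\<close> is an average of the column sums with weights \<open>\<mu>_out\<close>.

  A column sum consists of a zero on the diagonal, an entry equal to the eccentricity of \<open>w\<close>,
  and \<open>n - 2\<close> further entries that are at least 1. Hence \<open>s(w) \<ge> rad\<^sup>- + (n - 2)\<close>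
  for every \<open>w\<close>, and the average \<open>n\<^sup>2 / S\<close> satisfies the same bound. If the average meets the
  bound, then so does some single column of positive weight, and in that column the farthest vertex
  is at distance exactly \<open>rad\<^sup>-\<close> while the other \<open>n - 2\<close> entries are all 1
  (lemma \<open>in_radius_le_column_sum\<close>).
\<close>

section \<open>Distances in a strongly connected digraph\<close>

lemma digraph_dist_attained:
  assumes "fin_digraph G" "strongly_connected G" "v \<in> verts G" "w \<in> verts G"
  obtains p where "pre_digraph.apath G v p w" "digraph_dist G v w = real (length p)"
proof -
  interpret fin_digraph G by fact
  have cost: "awalk_cost (\<lambda>_. 1) p = real (length p)" for p
    by (induction p) auto
  have "v \<rightarrow>\<^sup>*\<^bsub>G\<^esub> w"
    using assms(2-4) by (auto simp: strongly_connected_def)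
  then obtain p where "apath v p w" "\<mu> (\<lambda>_. 1) v w = ereal (awalk_cost (\<lambda>_. 1) p)"
    using no_neg_cyc_reach_imp_path[of v w "\<lambda>_. 1"] by (auto simp: cost)
  then show thesis
    using that by (simp add: digraph_dist_def cost)
qed

lemma digraph_dist_self:
  assumes "fin_digraph G" "strongly_connected G" "v \<in> verts G"
  shows "digraph_dist G v v = 0"
proof -
  interpret fin_digraph G by fact
  obtain p where "apath v p v" "digraph_dist G v v = real (length p)"
    using digraph_dist_attained[OF assms assms(3)] .
  moreover from this(1) have "p = []"
    using apath_nonempty_ends by blast
  ultimately show ?thesis
    by simp
qed

lemma digraph_dist_ge_1:
  assumes "fin_digraph G" "strongly_connected G" "v \<in> verts G" "w \<in> verts G" "v \<noteq> w"
  shows "1 \<le> digraph_dist G v w"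
proof -
  interpret fin_digraph G by fact
  obtain p where p: "apath v p w" "digraph_dist G v w = real (length p)"
    using digraph_dist_attained[OF assms(1-4)] .
  have "p \<noteq> []"
    using p(1) \<open>v \<noteq> w\<close> by (auto simp: apath_def awalk_Nil_iff)
  then show ?thesis
    using p(2) by (cases p) auto
qed

section \<open>Column sums of the distance matrix and the in-radius\<close>

text \<open>
  The column of \<open>x\<close> is split into its diagonal entry, the entry of a farthest vertex, and the
  other \<open>n - 2\<close> entries, each of which exceeds 1 by a nonnegative amount. The same
  decomposition yields the inequality and its equality case. Having \<open>n \<ge> 2\<close> matters: the
  farthest vertex has to differ from \<open>x\<close>.
\<close>
lemma in_radius_le_column_sum:
  assumes G: "fin_digraph G" "strongly_connected G"
    and n: "2 \<le> card (verts G)" and x: "x \<in> verts G"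
  defines "s \<equiv> \<Sum>v\<in>verts G. digraph_dist G v x"
  shows "in_radius G + (real (card (verts G)) - 2) \<le> s"
    and "s = in_radius G + (real (card (verts G)) - 2) \<Longrightarrow>
      \<exists>w\<^sub>0\<in>verts G. (\<forall>w\<in>verts G. w \<noteq> x \<and> w \<noteq> w\<^sub>0 \<longrightarrow> digraph_dist G w x = 1) \<and>
        digraph_dist G w\<^sub>0 x = in_radius G"
proof -
  let ?V = "verts G"
  let ?ecc = "\<lambda>y. Max ((\<lambda>v. digraph_dist G v y) ` ?V)"
  have fin: "finite ?V"
    using G(1) by (rule fin_digraph.finite_verts)
  have "?ecc x \<in> (\<lambda>v. digraph_dist G v x) ` ?V"
    using fin x by (intro Max_in) auto
  then obtain z where z: "z \<in> ?V" "digraph_dist G z x = ?ecc x"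
    by auto
  have "\<not> ?V \<subseteq> {x}"
    using n card_mono[of "{x}" ?V] by auto
  then obtain y where y: "y \<in> ?V" "y \<noteq> x"
    by auto
  have "1 \<le> digraph_dist G y x"
    using digraph_dist_ge_1[OF G y(1) x y(2)] .
  also have "\<dots> \<le> digraph_dist G z x"
    using fin y(1) by (simp add: z(2))
  finally have "z \<noteq> x"
    using digraph_dist_self[OF G x] by auto
  define R where "R = ?V - {x, z}"
  have "card R = card ?V - 2"
    using \<open>z \<noteq> x\<close> x z(1) fin by (simp add: R_def card_Diff_subset)
  then have card_R: "real (card R) = real (card ?V) - 2"
    using n by simp
  have R_ge: "1 \<le> digraph_dist G v x" if "v \<in> R" for v
    using digraph_dist_ge_1[OF G _ x] that by (auto simp: R_def)
  have "s = (\<Sum>v\<in>{x, z}. digraph_dist G v x) + (\<Sum>v\<in>R. digraph_dist G v x)"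
    unfolding s_def R_def using fin x z(1) by (subst sum.subset_diff[of "{x, z}"]) auto
  also have "(\<Sum>v\<in>{x, z}. digraph_dist G v x) = ?ecc x"
    using \<open>z \<noteq> x\<close> z(2) digraph_dist_self[OF G x] by simp
  also have "(\<Sum>v\<in>R. digraph_dist G v x) =
      (real (card ?V) - 2) + (\<Sum>v\<in>R. digraph_dist G v x - 1)"
    by (simp add: sum_subtractf card_R)
  finally have s: "s = ?ecc x + (real (card ?V) - 2) + (\<Sum>v\<in>R. digraph_dist G v x - 1)"
    by simp
  have rad: "in_radius G \<le> ?ecc x"
    unfolding in_radius_def using fin x by (intro Min_le) auto
  have excess: "0 \<le> (\<Sum>v\<in>R. digraph_dist G v x - 1)"
    using R_ge by (intro sum_nonneg) simp
  show "in_radius G + (real (card ?V) - 2) \<le> s"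
    using s rad excess by linarith
  assume "s = in_radius G + (real (card ?V) - 2)"
  then have eq: "in_radius G = ?ecc x" and "(\<Sum>v\<in>R. digraph_dist G v x - 1) = 0"
    using s rad excess by linarith+
  then have "\<forall>v\<in>R. digraph_dist G v x - 1 = 0"
    using sum_nonneg_eq_0_iff[of R "\<lambda>v. digraph_dist G v x - 1"] R_ge fin
    by (simp add: R_def)
  then show "\<exists>w\<^sub>0\<in>?V. (\<forall>w\<in>?V. w \<noteq> x \<and> w \<noteq> w\<^sub>0 \<longrightarrow> digraph_dist G w x = 1) \<and>
        digraph_dist G w\<^sub>0 x = in_radius G"
    using z eq by (intro bexI[of _ z]) (auto simp: R_def)
qed

section \<open>Total mass of the curvatures\<close>

text \<open>
  Both sides, multiplied by \<open>n\<close>, are the value of \<open>L\<^sup>T D K\<close>.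
\<close>
lemma out_solution_sum_eq_in_solution_sum:
  assumes "out_solution G K" "in_solution G L"
  shows "(\<Sum>w\<in>verts G. K w) = (\<Sum>w\<in>verts G. L w)"
proof (cases "card (verts G) = 0")
  case True
  then show ?thesis
    by (auto simp: card_eq_0_iff)
next
  case False
  let ?V = "verts G" and ?n = "real (card (verts G))"
  have "?n * (\<Sum>v\<in>?V. L v) = (\<Sum>v\<in>?V. L v * (\<Sum>w\<in>?V. digraph_dist G v w * K w))"
    using assms(1) by (simp add: out_solution_def mult.commute flip: sum_distrib_right)
  also have "\<dots> = (\<Sum>w\<in>?V. K w * (\<Sum>v\<in>?V. digraph_dist G v w * L v))"
    by (simp add: sum_distrib_left mult_ac) (rule sum.swap)
  also have "\<dots> = ?n * (\<Sum>w\<in>?V. K w)"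
    using assms(2) by (simp add: in_solution_def mult.commute flip: sum_distrib_right)
  finally show ?thesis
    using False by simp
qed

lemma out_solution_weighted_column_sum:
  assumes "out_solution G K"
  shows "(\<Sum>w\<in>verts G. K w * (\<Sum>v\<in>verts G. digraph_dist G v w)) = (real (card (verts G)))\<^sup>2"
proof -
  have "(\<Sum>w\<in>verts G. K w * (\<Sum>v\<in>verts G. digraph_dist G v w)) =
      (\<Sum>v\<in>verts G. \<Sum>w\<in>verts G. digraph_dist G v w * K w)"
    by (simp add: sum_distrib_left mult.commute) (rule sum.swap)
  also have "\<dots> = (real (card (verts G)))\<^sup>2"
    using assms by (simp add: out_solution_def power2_eq_square)
  finally show ?thesis .
qed

text \<open>
  The distance matrix of a single vertex is \<open>0\<close>, and then \<open>D K = n 1\<close> reads \<open>0 = 1\<close>.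
\<close>
lemma out_solution_card_ge_2:
  assumes "fin_digraph G" "strongly_connected G" "out_solution G K"
  shows "2 \<le> card (verts G)"
proof (rule ccontr)
  assume "\<not> 2 \<le> card (verts G)"
  moreover have "card (verts G) \<noteq> 0"
    using assms(1,2) fin_digraph.finite_verts[of G]
    by (auto simp: strongly_connected_def)
  ultimately have "card (verts G) = 1"
    by linarith
  then obtain x where "verts G = {x}"
    by (auto simp: card_1_singleton_iff)
  then show False
    using assms(3) digraph_dist_self[OF assms(1,2), of x] by (simp add: out_solution_def)
qed

section \<open>The in-radius bound\<close>

theorem theorem4p12:
  fixes G :: "('a, 'b) pre_digraph"
    and n :: nat
    and \<mu>_out \<mu>_in :: "'a \<Rightarrow> real"
  assumes "digraph G"
    and "strongly_connected G"
    and "n = card (verts G)"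
    and "\<exists>K. out_solution G K"
    and "\<exists>K. in_solution G K"
    and "is_out_curvature G \<mu>_out"
    and "is_in_curvature G \<mu>_in"
    and "\<forall>v\<in>verts G. 0 \<le> \<mu>_out v"
  shows "in_radius G \<le> (real n)\<^sup>2 / (\<Sum>w\<in>verts G. \<mu>_in w) - (real n - 2) \<and>
    (in_radius G = (real n)\<^sup>2 / (\<Sum>w\<in>verts G. \<mu>_in w) - (real n - 2) \<longrightarrow>
      (\<exists>v\<^sub>0\<in>verts G. \<exists>w\<^sub>0\<in>verts G.
        (\<forall>w\<in>verts G. w \<noteq> v\<^sub>0 \<and> w \<noteq> w\<^sub>0 \<longrightarrow> digraph_dist G w v\<^sub>0 = 1) \<and>
        digraph_dist G w\<^sub>0 v\<^sub>0 = in_radius G))"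
proof -
  let ?V = "verts G" and ?S = "\<Sum>w\<in>verts G. \<mu>_in w"
  let ?s = "\<lambda>w. \<Sum>v\<in>verts G. digraph_dist G v w"
  let ?b = "in_radius G + (real n - 2)"
  have G: "fin_digraph G"
    using \<open>digraph G\<close> by (simp add: digraph_def)
  have fin: "finite ?V"
    using G by (rule fin_digraph.finite_verts)
  have out: "out_solution G \<mu>_out" and "in": "in_solution G \<mu>_in"
    using assms(6,7) by (simp_all add: is_out_curvature_def is_in_curvature_def is_arg_max_def)
  have card_ge: "2 \<le> card ?V"
    using out_solution_card_ge_2[OF G assms(2) out] .
  have mass: "(\<Sum>w\<in>?V. \<mu>_out w) = ?S"
    using out_solution_sum_eq_in_solution_sum[OF out "in"] .
  have bound: "?b \<le> ?s w" if "w \<in> ?V" for w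
    using in_radius_le_column_sum(1)[OF G assms(2) card_ge that] assms(3) by simp
  have pos: "\<exists>w\<in>?V. \<mu>_out w \<noteq> 0"
  proof (rule ccontr)
    assume "\<not> (\<exists>w\<in>?V. \<mu>_out w \<noteq> 0)"
    then show False
      using out_solution_weighted_column_sum[OF out] card_ge by simp
  qed
  then have S_pos: "0 < ?S"
    unfolding mass[symmetric] using assms(8) fin
    by (metis (no_types, lifting) less_eq_real_def sum_nonneg sum_nonneg_eq_0_iff)
  \<comment> \<open>\<open>n\<^sup>2 - S b\<close> is a sum of nonnegative terms, which gives the inequality; equality kills each term.\<close>
  have slack: "(\<Sum>w\<in>?V. \<mu>_out w * (?s w - ?b)) = (real n)\<^sup>2 - ?S * ?b"
    using out_solution_weighted_column_sum[OF out] assms(3)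
    by (simp add: right_diff_distrib sum_subtractf flip: mass sum_distrib_right)
  have slack_nonneg: "0 \<le> \<mu>_out w * (?s w - ?b)" if "w \<in> ?V" for w
    using bound[OF that] assms(8) that by simp
  have "0 \<le> (real n)\<^sup>2 - ?S * ?b"
    unfolding slack[symmetric] using slack_nonneg by (rule sum_nonneg)
  then have "?b \<le> (real n)\<^sup>2 / ?S"
    using S_pos by (simp add: pos_le_divide_eq mult.commute)
  moreover have "\<exists>v\<^sub>0\<in>?V. \<exists>w\<^sub>0\<in>?V.
        (\<forall>w\<in>?V. w \<noteq> v\<^sub>0 \<and> w \<noteq> w\<^sub>0 \<longrightarrow> digraph_dist G w v\<^sub>0 = 1) \<and>
        digraph_dist G w\<^sub>0 v\<^sub>0 = in_radius G"
    if "in_radius G = (real n)\<^sup>2 / ?S - (real n - 2)"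
  proof -
    have "?b = (real n)\<^sup>2 / ?S"
      using that by simp
    then have "(\<Sum>w\<in>?V. \<mu>_out w * (?s w - ?b)) = 0"
      unfolding slack using S_pos by simp
    then have zero: "\<mu>_out w * (?s w - ?b) = 0" if "w \<in> ?V" for w
      using sum_nonneg_eq_0_iff[OF fin slack_nonneg] that by simp
    obtain x where x: "x \<in> ?V" "\<mu>_out x \<noteq> 0"
      using pos by blast
    then have "?s x = ?b"
      using zero[of x] by simp
    then show ?thesis
      using in_radius_le_column_sum(2)[OF G assms(2) card_ge x(1)] assms(3) x(1) by auto
  qed
  ultimately show ?thesis
    by linarith
qed

end
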